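(* Let $\mathcal{K}$ be a unital associative algebra over $\mathbb{C}$ (not necessarily commutative), let $A$ be an $n\times n$ Manin matrix over $\mathcal{K}$, and let $A'$ be an arbitrary $n\times n$ matrix over $\mathcal{K}$ such that all entries of $A'$ commute with all entries of $A$, i.e. $[A_{ij},A'_{kl}]=0$ for all $i,j,k,l$. Then $$\det{}^{col}(AA')=\det{}^{col}(A)\,\det{}^{col}(A').$$ If $A'$ is also a Manin matrix, then $AA'$ is a Manin matrix.
   Context: A (possibly rectangular) matrix $M=(M_{ij})$ with entries in an associative ring $\mathcal{K}$ is called a Manin matrix if (1) entries lying in the same column commute with each other, and (2) $[M_{ij},M_{kl}]=[M_{kj},M_{il}]$ for all $i,j,k,l$, where $[a,b]=ab-ba$. For any $n\times n$ matrix $X$ over $\mathcal{K}$, $\det^{col}(X)=\sum_{\sigma\in S_n}\operatorname{sgn}(\sigma)\,X_{\sigma(1)1}X_{\sigma(2)2}\cdots X_{\sigma(n)n}$. *)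

theory Defs
  imports Jordan_Normal_Form.Matrix "HOL-Combinatorics.Permutations"
begin

text \<open>The class constraint \<open>{ring, monoid_mult}\<close> means an associative unital ring; unlike
  \<open>ring_1\<close> it does not exclude the zero ring.\<close>

locale unital_complex_algebra = vector_space scale
  for scale :: "complex \<Rightarrow> 'k::{ring, monoid_mult} \<Rightarrow> 'k" +
  assumes scale_mult_left: "scale c x * y = scale c (x * y)"
    and scale_mult_right: "x * scale c y = scale c (x * y)"

definition commutator :: "'k::ring \<Rightarrow> 'k \<Rightarrow> 'k" where
  "commutator a b = a * b - b * a"

definition manin_matrix :: "'k::ring mat \<Rightarrow> bool" where
  "manin_matrix M \<longleftrightarrow>
     (\<forall>i<dim_row M. \<forall>k<dim_row M. \<forall>j<dim_col M.
        M $$ (i, j) * M $$ (k, j) = M $$ (k, j) * M $$ (i, j)) \<and>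
     (\<forall>i<dim_row M. \<forall>k<dim_row M. \<forall>j<dim_col M. \<forall>l<dim_col M.
        commutator (M $$ (i, j)) (M $$ (k, l)) = commutator (M $$ (k, j)) (M $$ (i, l)))"

text \<open>The factors of each summand are multiplied as a list, in increasing order of the column
  index, since the entries need not commute. The conditional is the sign of \<open>p\<close>
  as an element of the ring. Only square matrices are meaningful arguments.\<close>

definition det_col :: "'k::{ring, monoid_mult} mat \<Rightarrow> 'k" where
  "det_col X =
     (\<Sum>p | p permutes {0..<dim_col X}.
        (if evenperm p then 1 else - 1) * prod_list (map (\<lambda>j. X $$ (p j, j)) [0..<dim_col X]))"

end

theory Submission
  imports Defs
begin

text \<open>Condition (2) on Manin matrices says precisely that exchanging two adjacent columns changes
  the sign of the column determinant, and it survives any selection of columns, with repetitions.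
  Hence the determinant of the columns \<open>f 0, \<dots>, f (n - 1)\<close> of \<open>A\<close> is \<open>sgn f \<sqdot> det A\<close> if \<open>f\<close> is a
  permutation, and vanishes otherwise, since there is no additive 2-torsion over the complex numbers.
  Expanding \<open>det (A A')\<close> column by column into such determinants, with the entries of
  \<open>A'\<close> moved to the right, gives multiplicativity.
  For the second claim, the defect of condition (2) for \<open>A A'\<close> is a double sum of products of a
  factor antisymmetric and a factor symmetric in the two summation indices.\<close>

section \<open>Products over lists\<close>

lemma prod_list_commute:
  fixes a :: "'k::monoid_mult"
  assumes "\<And>j. j \<in> set js \<Longrightarrow> a * x j = x j * a"
  shows "a * prod_list (map x js) = prod_list (map x js) * a"
  using assms
proof (induction js)
  case (Cons j js)
  have "a * (x j * prod_list (map x js)) = x j * (a * prod_list (map x js))"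
    using Cons.prems[of j] by (simp add: mult.assoc[symmetric])
  also have "a * prod_list (map x js) = prod_list (map x js) * a"
    using Cons by simp
  finally show ?case
    by (simp add: mult.assoc)
qed simp

text \<open>Each \<open>y i\<close> moves right past the later \<open>x j\<close> only, so the order
  inside each of the two families is kept.\<close>

lemma prod_list_mult_commuting:
  fixes x y :: "'i \<Rightarrow> 'k::monoid_mult"
  assumes "\<And>i j. i \<in> set js \<Longrightarrow> j \<in> set js \<Longrightarrow> y i * x j = x j * y i"
  shows "prod_list (map (\<lambda>j. x j * y j) js) = prod_list (map x js) * prod_list (map y js)"
  using assms
proof (induction js)
  case (Cons i js)
  let ?X = "prod_list (map x js)" and ?Y = "prod_list (map y js)"
  have "prod_list (map (\<lambda>j. x j * y j) (i # js)) = x i * (y i * ?X) * ?Y"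
    using Cons by (simp add: mult.assoc)
  also have "y i * ?X = ?X * y i"
    using Cons.prems by (intro prod_list_commute) simp
  finally show ?case
    by (simp add: mult.assoc)
qed simp

text \<open>Fixing \<open>f\<close> outside \<open>{0..<m}\<close> makes the permutations of \<open>{0..<m}\<close> a subset of these functions.\<close>

definition bounded_funs :: "nat \<Rightarrow> nat \<Rightarrow> (nat \<Rightarrow> nat) set" where
  "bounded_funs m n = {f. (\<forall>j<m. f j < n) \<and> (\<forall>j\<ge>m. f j = j)}"

lemma finite_bounded_funs: "finite (bounded_funs m n)"
  using finite_bounded_functions[of "{0..<n}" "{0..<m}"]
  by (rule rev_finite_subset) (auto simp: bounded_funs_def)

lemma permutes_bounded_funs: "p permutes {0..<n} \<Longrightarrow> p \<in> bounded_funs n n"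
  using permutes_in_image[of p "{0..<n}"] permutes_not_in[of p "{0..<n}"]
  by (auto simp: bounded_funs_def)

lemma bounded_funs_permutes:
  assumes "f \<in> bounded_funs n n" and "inj_on f {0..<n}"
  shows "f permutes {0..<n}"
proof (rule bij_imp_permutes)
  have "f ` {0..<n} \<subseteq> {0..<n}"
    using assms(1) by (auto simp: bounded_funs_def)
  with assms(2) show "bij_betw f {0..<n} {0..<n}"
    by (simp add: bij_betw_def endo_inj_surj)
qed (use assms(1) in \<open>auto simp: bounded_funs_def\<close>)

text \<open>Distributivity with the factors kept in order: each \<open>f\<close> chooses one summand
  per factor. The number \<open>m\<close> of factors is separate from the range \<open>n\<close> of
  the choices, so that the induction can vary it alone.\<close>

lemma prod_list_sum_distrib:
  fixes F :: "nat \<Rightarrow> nat \<Rightarrow> 'k::{semiring_0, monoid_mult}"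
  shows "prod_list (map (\<lambda>j. \<Sum>k<n. F j k) [0..<m]) =
    (\<Sum>f\<in>bounded_funs m n. prod_list (map (\<lambda>j. F j (f j)) [0..<m]))"
proof (induction m)
  case 0
  have "bounded_funs 0 n = {id}"
    by (auto simp: bounded_funs_def)
  then show ?case by simp
next
  case (Suc m)
  have "prod_list (map (\<lambda>j. \<Sum>k<n. F j k) [0..<Suc m]) =
      (\<Sum>(f, k)\<in>bounded_funs m n \<times> {..<n}. prod_list (map (\<lambda>j. F j (f j)) [0..<m]) * F m k)"
    by (simp add: Suc sum_product sum.cartesian_product)
  also have "\<dots> = (\<Sum>f\<in>bounded_funs (Suc m) n. prod_list (map (\<lambda>j. F j (f j)) [0..<Suc m]))"
  \<comment> \<open>A function on \<open>m + 1\<close> arguments is a function on \<open>m\<close>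
    arguments and a last value. Resetting the value at \<open>m\<close> to \<open>m\<close> restores
    the convention that arguments from \<open>m\<close> on are fixed.\<close>
  proof (rule sum.reindex_bij_witness[where i = "\<lambda>f. (f(m := m), f m)" and j = "\<lambda>(f, k). f(m := k)"])
    fix fk assume "fk \<in> bounded_funs m n \<times> {..<n}"
    then obtain f k where fk: "fk = (f, k)" "f \<in> bounded_funs m n" "k < n"
      by auto
    then show "(((\<lambda>(f, k). f(m := k)) fk)(m := m), (\<lambda>(f, k). f(m := k)) fk m) = fk"
      by (auto simp: bounded_funs_def fun_eq_iff)
    show "(\<lambda>(f, k). f(m := k)) fk \<in> bounded_funs (Suc m) n"
      using fk by (auto simp: bounded_funs_def)
    have "map (\<lambda>j. F j ((f(m := k)) j)) [0..<m] = map (\<lambda>j. F j (f j)) [0..<m]"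
      by simp
    then show "prod_list (map (\<lambda>j. F j ((\<lambda>(f, k). f(m := k)) fk j)) [0..<Suc m]) =
        (case fk of (f, k) \<Rightarrow> prod_list (map (\<lambda>j. F j (f j)) [0..<m]) * F m k)"
      using fk by (simp del: map_eq_conv)
  qed (auto simp: bounded_funs_def less_Suc_eq)
  finally show ?case .
qed

section \<open>Column determinants and column exchanges\<close>

text \<open>Takes its value in the ring itself: mapping the integer sign by \<open>of_int\<close>
  would require \<open>ring_1\<close> and exclude the zero ring.\<close>

definition perm_sgn :: "(nat \<Rightarrow> nat) \<Rightarrow> 'k::{ring, monoid_mult}" where
  "perm_sgn p = (if evenperm p then 1 else - 1)"

lemma perm_sgn_id: "perm_sgn id = 1"
  by (simp add: perm_sgn_def)

lemma perm_sgn_comp_transpose: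
  assumes "p permutes {0..<n}" and "a \<noteq> b"
  shows "perm_sgn (p \<circ> transpose a b) = - perm_sgn p"
proof -
  have "permutation p"
    using assms(1) by (auto simp: permutation_permutes)
  with assms(2) show ?thesis
    by (simp add: perm_sgn_def evenperm_comp permutation_swap_id evenperm_swap)
qed

lemma perm_sgn_commute: "x * perm_sgn p = perm_sgn p * x"
  by (simp add: perm_sgn_def)

text \<open>The entries form a function, so that selecting columns, with repetitions allowed, is
  composition with an index map.\<close>

definition column_det :: "nat \<Rightarrow> (nat \<Rightarrow> nat \<Rightarrow> 'k::{ring, monoid_mult}) \<Rightarrow> 'k" where
  "column_det n B =
     (\<Sum>p | p permutes {0..<n}. perm_sgn p * prod_list (map (\<lambda>j. B (p j) j) [0..<n]))"

lemma det_col_conv_column_det: "det_col X = column_det (dim_col X) (\<lambda>i j. X $$ (i, j))"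
  by (simp add: det_col_def column_det_def perm_sgn_def)

lemma column_det_cong:
  assumes "\<And>i j. i < n \<Longrightarrow> j < n \<Longrightarrow> B i j = C i j"
  shows "column_det n B = column_det n C"
  unfolding column_det_def
proof (intro sum.cong refl arg_cong2[of _ _ _ _ times] arg_cong[of _ _ prod_list] map_cong)
  fix p j assume "p \<in> {p. p permutes {0..<n}}" "j \<in> set [0..<n]"
  then show "B (p j) j = C (p j) j"
    using assms permutes_in_image[of p "{0..<n}" j] by auto
qed

text \<open>Condition (2) alone. Its case \<open>j = l\<close> yields condition (1) once there is no
  additive 2-torsion.\<close>

definition cross_commuting :: "nat \<Rightarrow> (nat \<Rightarrow> nat \<Rightarrow> 'k::ring) \<Rightarrow> bool" where
  "cross_commuting n B \<longleftrightarrow> (\<forall>i<n. \<forall>k<n. \<forall>j<n. \<forall>l<n.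
     commutator (B i j) (B k l) = commutator (B k j) (B i l))"

lemma cross_commuting_cong:
  assumes "\<And>i j. i < n \<Longrightarrow> j < n \<Longrightarrow> B i j = C i j"
  shows "cross_commuting n B \<longleftrightarrow> cross_commuting n C"
  using assms by (simp add: cross_commuting_def)

lemma cross_commuting_columns:
  "cross_commuting n B \<Longrightarrow> (\<And>j. j < n \<Longrightarrow> f j < n) \<Longrightarrow> cross_commuting n (\<lambda>i j. B i (f j))"
  by (simp add: cross_commuting_def)

lemma transpose_less: "a < n \<Longrightarrow> b < n \<Longrightarrow> j < n \<Longrightarrow> transpose a b j < (n::nat)"
  by (simp add: transpose_def)

text \<open>The determinants are averaged over \<open>p\<close> and \<open>p \<circ> transpose i (i + 1)\<close>, so that condition (2)
  applies to each summand; this produces the doubled equation.\<close>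

lemma column_det_swap_adjacent:
  fixes B :: "nat \<Rightarrow> nat \<Rightarrow> 'k::{ring, monoid_mult}"
  assumes two: "\<And>x::'k. x + x = 0 \<Longrightarrow> x = 0"
    and B: "cross_commuting n B" and i: "Suc i < n"
  shows "column_det n (\<lambda>r j. B r (transpose i (Suc i) j)) = - column_det n B"
proof -
  define s where "s = transpose i (Suc i)"
  define T where "T C p = prod_list (map (\<lambda>j. C (p j) j) [0..<n])"
    for C :: "nat \<Rightarrow> nat \<Rightarrow> 'k" and p :: "nat \<Rightarrow> nat"
  let ?C = "\<lambda>r j. B r (s j)"
  have s: "s permutes {0..<n}"
    using i by (auto simp: s_def intro: permutes_swap_id)
  have det_T: "column_det n C = (\<Sum>p | p permutes {0..<n}. perm_sgn p * T C p)" for C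
    by (simp add: column_det_def T_def)
  \<comment> \<open>Substituting \<open>p \<circ> s\<close> for \<open>p\<close> permutes the
    summands and reverses every sign.\<close>
  have reindex: "column_det n C = (\<Sum>p | p permutes {0..<n}. - perm_sgn p * T C (p \<circ> s))" for C
  proof -
    have "column_det n C = (\<Sum>p | p permutes {0..<n}. perm_sgn (p \<circ> s) * T C (p \<circ> s))"
      unfolding det_T by (rule sum_permutations_compose_right[OF s])
    then show ?thesis
      by (simp add: s_def perm_sgn_comp_transpose)
  qed
  have split: "[0..<n] = [0..<i] @ [i, Suc i] @ [Suc (Suc i)..<n]"
    using i upt_add_eq_append[of 0 i "n - i"] by (simp add: upt_conv_Cons)
  \<comment> \<open>Only the adjacent factors at \<open>i\<close> and \<open>Suc i\<close> are
    affected by \<open>s\<close>, so the four products in \<open>cancel\<close> share the outer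
    factors \<open>?P\<close> and \<open>?Q\<close>.\<close>
  have outer: "map (\<lambda>j. C (p (s j)) j) js = map (\<lambda>j. C (p j) j) js"
    "map (\<lambda>j. B (p j) (s j)) js = map (\<lambda>j. B (p j) j) js"
    "map (\<lambda>j. B (p (s j)) (s j)) js = map (\<lambda>j. B (p j) j) js"
    if "i \<notin> set js" "Suc i \<notin> set js" for p js and C :: "nat \<Rightarrow> nat \<Rightarrow> 'k"
    using that by (auto simp: s_def transpose_def)
  have cancel: "T B p - T B (p \<circ> s) + (T ?C p - T ?C (p \<circ> s)) = 0" if "p permutes {0..<n}" for p
  proof -
    let ?P = "prod_list (map (\<lambda>j. B (p j) j) [0..<i])"
    let ?Q = "prod_list (map (\<lambda>j. B (p j) j) [Suc (Suc i)..<n])"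
    define a b where "a = p i" and "b = p (Suc i)"
    have ab: "a < n" "b < n"
      using i permutes_in_image[OF that, of i] permutes_in_image[OF that, of "Suc i"]
      by (auto simp: a_def b_def)
    have "T B p - T B (p \<circ> s) + (T ?C p - T ?C (p \<circ> s)) =
      ?P * ((B a i * B b (Suc i) - B b i * B a (Suc i)
        + (B a (Suc i) * B b i - B b (Suc i) * B a i)) * ?Q)"
      by (simp add: T_def split outer a_def b_def s_def[symmetric])
        (simp add: s_def algebra_simps)
    \<comment> \<open>The four middle products regroup into the two commutators that condition (2)
      equates.\<close>
    also have "B a i * B b (Suc i) - B b i * B a (Suc i)
        + (B a (Suc i) * B b i - B b (Suc i) * B a i) = 
        commutator (B a i) (B b (Suc i)) - commutator (B b i) (B a (Suc i))"
      by (simp add: commutator_def)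
    also have "\<dots> = 0"
      using B ab i by (simp add: cross_commuting_def)
    finally show ?thesis
      by (simp only: mult_zero_left mult_zero_right)
  qed
  have "(column_det n B + column_det n ?C) + (column_det n B + column_det n ?C) =
     (column_det n B + (\<Sum>p | p permutes {0..<n}. - perm_sgn p * T B (p \<circ> s))) +
     (column_det n ?C + (\<Sum>p | p permutes {0..<n}. - perm_sgn p * T ?C (p \<circ> s)))"
    unfolding reindex[symmetric] by (simp add: algebra_simps)
  also have "\<dots> = (\<Sum>p | p permutes {0..<n}.
      perm_sgn p * (T B p - T B (p \<circ> s) + (T ?C p - T ?C (p \<circ> s))))"
    by (simp add: det_T sum.distrib[symmetric] algebra_simps)
  also have "\<dots> = 0"
    by (rule sum.neutral) (simp add: cancel)
  finally have "column_det n B + column_det n ?C = 0"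
    by (rule two)
  then show ?thesis
    by (simp add: s_def eq_neg_iff_add_eq_0 add.commute)
qed

section \<open>Exchanging and permuting arbitrary columns\<close>

text \<open>Induction on the distance of the columns, starting from adjacent ones. \<open>B\<close>
  is generalized because the hypotheses are applied to matrices whose columns have already been
  exchanged.\<close>

lemma column_det_swap:
  fixes B :: "nat \<Rightarrow> nat \<Rightarrow> 'k::{ring, monoid_mult}"
  assumes two: "\<And>x::'k. x + x = 0 \<Longrightarrow> x = 0"
    and "cross_commuting n B" and "a < b" and "b < n"
  shows "column_det n (\<lambda>r j. B r (transpose a b j)) = - column_det n B"
  using assms(3,2,4)
proof (induction a b arbitrary: B rule: less_Suc_induct)
  case (1 a)
  then show ?case by (intro column_det_swap_adjacent[OF two]) auto
next
  case (2 a b c)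
  let ?t = "transpose a b" and ?u = "transpose b c"
  \<comment> \<open>Conjugation writes \<open>transpose a c\<close> as three exchanges of columns at
    shorter distance, and three sign changes amount to one.\<close>
  have eq: "transpose a c j = ?u (?t (?u j))" for j
    using 2(1,2) by (auto simp: transpose_def)
  have cc: "cross_commuting n (\<lambda>r j. B r (?u j))" "cross_commuting n (\<lambda>r j. B r (?u (?t j)))"
    using 2(1,2,6) by (auto intro!: cross_commuting_columns[OF 2(5)] transpose_less)
  show ?case
    unfolding eq using 2(2,6) by (simp add: 2(3)[OF cc(1)] 2(4)[OF cc(2)] 2(4)[OF 2(5)])
qed

text \<open>\<open>permutes_rev_induct\<close> builds \<open>p\<close> by composing transpositions
  on the right, and each of these exchanges two columns of the matrix already permuted.\<close>

lemma column_det_permute_columns: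
  fixes B :: "nat \<Rightarrow> nat \<Rightarrow> 'k::{ring, monoid_mult}"
  assumes two: "\<And>x::'k. x + x = 0 \<Longrightarrow> x = 0"
    and B: "cross_commuting n B" and p: "p permutes {0..<n}"
  shows "column_det n (\<lambda>r j. B r (p j)) = perm_sgn p * column_det n B"
  using finite_atLeastLessThan p
proof (induction p rule: permutes_rev_induct)
  case id
  then show ?case by (simp add: perm_sgn_id[unfolded id_def])
next
  case (swap a b p)
  have cc: "cross_commuting n (\<lambda>r j. B r (p j))"
    using permutes_in_image[OF \<open>p permutes {0..<n}\<close>] by (intro cross_commuting_columns[OF B]) simp
  have "column_det n (\<lambda>r j. B r (p (transpose a b j))) = - column_det n (\<lambda>r j. B r (p j))"
    using swap(1-3) column_det_swap[OF two cc, of a b] column_det_swap[OF two cc, of b a]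
    by (cases a b rule: linorder_cases) (simp_all add: transpose_commute)
  then show ?case
    using swap perm_sgn_comp_transpose[of p n a b, where 'a = 'k] by (simp add: o_def)
qed

text \<open>Exchanging the equal columns both fixes and negates the determinant, so its double is
  zero.\<close>

lemma column_det_eq_columns:
  fixes B :: "nat \<Rightarrow> nat \<Rightarrow> 'k::{ring, monoid_mult}"
  assumes two: "\<And>x::'k. x + x = 0 \<Longrightarrow> x = 0"
    and B: "cross_commuting n B" and ab: "a < b" "b < n"
    and eq: "\<And>r. B r a = B r b"
  shows "column_det n B = 0"
proof -
  have "(\<lambda>r j. B r (transpose a b j)) = B"
    using eq by (auto simp: transpose_def fun_eq_iff)
  then have "column_det n B = - column_det n B"
    using column_det_swap[OF two B ab] by simp
  then show ?thesis
    by (rule two[OF eq_neg_iff_add_eq_0[THEN iffD1]])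
qed

section \<open>Products of Manin matrices\<close>

lemma column_det_mult:
  fixes A B :: "nat \<Rightarrow> nat \<Rightarrow> 'k::{ring, monoid_mult}"
  assumes two: "\<And>x::'k. x + x = 0 \<Longrightarrow> x = 0"
    and A: "cross_commuting n A"
    and comm: "\<And>i j k l. i < n \<Longrightarrow> j < n \<Longrightarrow> k < n \<Longrightarrow> l < n \<Longrightarrow> A i j * B k l = B k l * A i j"
  shows "column_det n (\<lambda>i j. \<Sum>k<n. A i k * B k j) = column_det n A * column_det n B"
proof -
  let ?S = "{p. p permutes {0..<n}}" and ?F = "bounded_funs n n"
  let ?b = "\<lambda>f. prod_list (map (\<lambda>j. B (f j) j) [0..<n])"
  have expand: "prod_list (map (\<lambda>j. \<Sum>k<n. A (p j) k * B k j) [0..<n]) =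
      (\<Sum>f\<in>?F. prod_list (map (\<lambda>j. A (p j) (f j)) [0..<n]) * ?b f)"
    if "p \<in> ?S" for p
  proof -
    have p: "p j < n" if "j < n" for j
      using \<open>p \<in> ?S\<close> permutes_in_image[of p "{0..<n}" j] that by simp
    show ?thesis
      unfolding prod_list_sum_distrib
      using p comm by (intro sum.cong refl prod_list_mult_commuting) (auto simp: bounded_funs_def)
  qed
  have "column_det n (\<lambda>i j. \<Sum>k<n. A i k * B k j) =
      (\<Sum>p\<in>?S. \<Sum>f\<in>?F. perm_sgn p * prod_list (map (\<lambda>j. A (p j) (f j)) [0..<n]) * ?b f)"
    unfolding column_det_def by (intro sum.cong refl) (simp only: expand sum_distrib_left mult.assoc)
  \<comment> \<open>For a fixed choice \<open>f\<close>, the factor \<open>?b f\<close> does not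
    depend on \<open>p\<close>, and the sum over \<open>p\<close> is the determinant of the selected
    columns.\<close>
  also have "\<dots> = (\<Sum>f\<in>?F. column_det n (\<lambda>i j. A i (f j)) * ?b f)"
    unfolding column_det_def sum_distrib_right by (rule sum.swap)
  \<comment> \<open>A choice that is not a permutation repeats a column, hence contributes
    zero.\<close>
  also have "\<dots> = (\<Sum>f\<in>?S. column_det n (\<lambda>i j. A i (f j)) * ?b f)"
  proof (rule sum.mono_neutral_right)
    show "\<forall>f\<in>?F - ?S. column_det n (\<lambda>i j. A i (f j)) * ?b f = 0"
    proof
      fix f assume f: "f \<in> ?F - ?S"
      then have "\<not> inj_on f {0..<n}"
        using bounded_funs_permutes by blast
      then obtain a b where "a < b" "b < n" "f a = f b"
        by (auto simp: inj_on_def) (metis linorder_neqE_nat)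
      moreover have "cross_commuting n (\<lambda>i j. A i (f j))"
        using f by (intro cross_commuting_columns[OF A]) (auto simp: bounded_funs_def)
      ultimately have "column_det n (\<lambda>i j. A i (f j)) = 0"
        by (intro column_det_eq_columns[OF two, where a = a and b = b]) auto
      then show "column_det n (\<lambda>i j. A i (f j)) * ?b f = 0"
        by simp
    qed
  qed (auto simp: finite_bounded_funs permutes_bounded_funs)
  \<comment> \<open>The sign is central, so it moves past the determinant of \<open>A\<close> to
    join \<open>?b f\<close>; these terms sum to the determinant of \<open>B\<close>.\<close>
  also have "\<dots> = (\<Sum>f\<in>?S. column_det n A * (perm_sgn f * ?b f))"
    by (intro sum.cong refl)
      (simp add: column_det_permute_columns[OF two A] mult.assoc
        perm_sgn_commute[of "column_det n A", symmetric])
  also have "\<dots> = column_det n A * column_det n B"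
    by (simp add: column_det_def sum_distrib_left)
  finally show ?thesis .
qed

lemma cross_commuting_mult:
  fixes A B :: "nat \<Rightarrow> nat \<Rightarrow> 'k::ring"
  assumes two: "\<And>x::'k. x + x = 0 \<Longrightarrow> x = 0"
    and A: "cross_commuting n A" and B: "cross_commuting n B"
    and comm: "\<And>i j k l. i < n \<Longrightarrow> j < n \<Longrightarrow> k < n \<Longrightarrow> l < n \<Longrightarrow> A i j * B k l = B k l * A i j"
  shows "cross_commuting n (\<lambda>i j. \<Sum>k<n. A i k * B k j)"
  unfolding cross_commuting_def
proof (intro allI impI)
  fix i k j l assume ijkl: "i < n" "k < n" "j < n" "l < n"
  let ?C = "\<lambda>i j. \<Sum>k<n. A i k * B k j"
  \<comment> \<open>Condition (2) for \<open>A\<close>, rearranged, says that \<open>X\<close> is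
    antisymmetric in \<open>s\<close> and \<open>t\<close>; for \<open>B\<close> it says that
    \<open>Y\<close> is symmetric.\<close>
  define X where "X s t = A i s * A k t - A k s * A i t" for s t
  define Y where "Y s t = B s j * B t l + B s l * B t j" for s t
  have prod: "?C p q * ?C r u = (\<Sum>s<n. \<Sum>t<n. A p s * A r t * (B s q * B t u))"
    if "p < n" "q < n" "r < n" "u < n" for p q r u
  proof -
    have "A p s * B s q * (A r t * B t u) = A p s * A r t * (B s q * B t u)"
      if "s < n" "t < n" for s t
      using comm[of r t s q] that \<open>r < n\<close> \<open>q < n\<close> by (metis mult.assoc)
    then show ?thesis
      by (simp add: sum_product)
  qed
  have anti: "X s t = - X t s" if "s < n" "t < n" for s t
  proof -
    have "commutator (A i s) (A k t) = commutator (A k s) (A i t)"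
      using A ijkl that by (simp add: cross_commuting_def)
    then show ?thesis
      by (simp add: X_def commutator_def algebra_simps)
  qed
  have sym: "Y s t = Y t s" if "s < n" "t < n" for s t
  proof -
    have "commutator (B s j) (B t l) = commutator (B t j) (B s l)"
      using B ijkl that by (simp add: cross_commuting_def)
    then show ?thesis
      by (simp add: Y_def commutator_def algebra_simps)
  qed
  define S where "S = (\<Sum>s<n. \<Sum>t<n. X s t * Y s t)"
  have "S = (\<Sum>t<n. \<Sum>s<n. X s t * Y s t)"
    unfolding S_def by (rule sum.swap)
  also have "\<dots> = (\<Sum>t<n. \<Sum>s<n. - (X t s * Y t s))"
    by (intro sum.cong refl) (metis anti sym lessThan_iff minus_mult_left)
  also have "\<dots> = - S"
    by (simp add: S_def sum_negf)
  finally have "S = 0"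
    by (rule two[OF eq_neg_iff_add_eq_0[THEN iffD1]])
  \<comment> \<open>In all four products \<open>s\<close> is the summation index of the left factor
    and \<open>t\<close> that of the right one; the terms then group into
    \<open>X s t * Y s t\<close>.\<close>
  moreover have "commutator (?C i j) (?C k l) - commutator (?C k j) (?C i l) = S"
    unfolding commutator_def prod[OF ijkl(1,3,2,4)] prod[OF ijkl(2,4,1,3)]
      prod[OF ijkl(2,3,1,4)] prod[OF ijkl(1,4,2,3)] S_def
    by (simp add: X_def Y_def sum_subtractf sum.distrib algebra_simps)
  ultimately show "commutator (?C i j) (?C k l) = commutator (?C k j) (?C i l)"
    by simp
qed

section \<open>Transfer to matrices over a complex algebra\<close>

text \<open>For entries in one column, condition (2) reads [a,b] = [b,a], so twice the commutator is
  zero and condition (1) follows.\<close>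

lemma manin_matrix_iff_cross_commuting:
  fixes M :: "'k::ring mat"
  assumes two: "\<And>x::'k. x + x = 0 \<Longrightarrow> x = 0" and "M \<in> carrier_mat n n"
  shows "manin_matrix M \<longleftrightarrow> cross_commuting n (\<lambda>i j. M $$ (i, j))"
proof -
  have dims: "dim_row M = n" "dim_col M = n"
    using assms(2) by auto
  show ?thesis
  proof
    assume M: "cross_commuting n (\<lambda>i j. M $$ (i, j))"
    have "M $$ (i, j) * M $$ (k, j) = M $$ (k, j) * M $$ (i, j)" if "i < n" "k < n" "j < n" for i j k
    proof -
      have "commutator (M $$ (i, j)) (M $$ (k, j)) = commutator (M $$ (k, j)) (M $$ (i, j))"
        using M that by (simp add: cross_commuting_def)
      also have "\<dots> = - commutator (M $$ (i, j)) (M $$ (k, j))"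
        by (simp add: commutator_def)
      finally have "commutator (M $$ (i, j)) (M $$ (k, j)) = 0"
        by (rule two[OF eq_neg_iff_add_eq_0[THEN iffD1]])
      then show ?thesis
        by (simp add: commutator_def)
    qed
    with M show "manin_matrix M"
      unfolding manin_matrix_def cross_commuting_def dims by blast
  next
    assume "manin_matrix M"
    then show "cross_commuting n (\<lambda>i j. M $$ (i, j))"
      unfolding manin_matrix_def cross_commuting_def dims by blast
  qed
qed

text \<open>The complex scalars enter here: \<open>x + x\<close> is \<open>scale 2 x\<close>, and
  scaling by a nonzero number is injective.\<close>

lemma (in unital_complex_algebra) add_self_eq_0:
  fixes x :: 'k
  assumes "x + x = 0"
  shows "x = 0"
proof -
  have "scale 2 x = x + x"
    using scale_left_distrib[of 1 1 x] by simp
  with assms show ?thesis by simp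
qed

theorem proposition4:
  fixes scale :: "complex \<Rightarrow> 'k::{ring, monoid_mult} \<Rightarrow> 'k"
    and A A' :: "'k mat"
    and n :: nat
  assumes "unital_complex_algebra scale"
    and "A \<in> carrier_mat n n"
    and "A' \<in> carrier_mat n n"
    and "manin_matrix A"
    and "\<And>i j k l. i < n \<Longrightarrow> j < n \<Longrightarrow> k < n \<Longrightarrow> l < n \<Longrightarrow>
           commutator (A $$ (i, j)) (A' $$ (k, l)) = 0"
  shows "det_col (A * A') = det_col A * det_col A' \<and>
         (manin_matrix A' \<longrightarrow> manin_matrix (A * A'))"
proof -
  let ?a = "\<lambda>i j. A $$ (i, j)" and ?b = "\<lambda>i j. A' $$ (i, j)"
  have two: "x = 0" if "x + x = 0" for x :: 'k
    using unital_complex_algebra.add_self_eq_0[OF assms(1) that] .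
  have manin_iff: "manin_matrix M \<longleftrightarrow> cross_commuting n (\<lambda>i j. M $$ (i, j))"
    if "M \<in> carrier_mat n n" for M :: "'k mat"
    by (rule manin_matrix_iff_cross_commuting[OF two that])
  have comm: "?a i j * ?b k l = ?b k l * ?a i j" if "i < n" "j < n" "k < n" "l < n" for i j k l
    using assms(5)[OF that] by (simp add: commutator_def)
  have A: "cross_commuting n ?a"
    using assms(2,4) by (simp add: manin_iff)
  have AA': "A * A' \<in> carrier_mat n n"
    using assms(2,3) by simp
  have entry: "(A * A') $$ (i, j) = (\<Sum>k<n. ?a i k * ?b k j)" if "i < n" "j < n" for i j
    using assms(2,3) that by (simp add: scalar_prod_def lessThan_atLeast0)
  have "det_col (A * A') = column_det n (\<lambda>i j. \<Sum>k<n. ?a i k * ?b k j)"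
    using assms(3) column_det_cong[OF entry] by (simp add: det_col_conv_column_det)
  also have "\<dots> = det_col A * det_col A'"
    using assms(2,3) column_det_mult[OF two A comm] by (simp add: det_col_conv_column_det)
  finally have det: "det_col (A * A') = det_col A * det_col A'" .
  have manin: "manin_matrix (A * A')" if "manin_matrix A'"
  proof -
    have "cross_commuting n (\<lambda>i j. \<Sum>k<n. ?a i k * ?b k j)"
      using manin_iff[OF assms(3)] that by (intro cross_commuting_mult[OF two A _ comm]) blast+
    then have "cross_commuting n (\<lambda>i j. (A * A') $$ (i, j))"
      by (rule cross_commuting_cong[THEN iffD2, rotated]) (rule entry)
    then show ?thesis
      by (rule manin_iff[OF AA', THEN iffD2])
  qed
  show ?thesis
    by (intro conjI impI det manin)
qed

end
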